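(* The convergence exponent $\lambda^* \colon [0,1] \to [0,1]$ is discontinuous everywhere, i.e., it is not continuous at any point of $[0,1]$.
   Context: Pierce digits. For $x \in [0,1]$, define $d_1(x) := \lfloor 1/x \rfloor$ and $T(x) := 1 - d_1(x)\,x$ if $x \neq 0$, and $d_1(0) := \infty$, $T(0) := 0$. Here $\lfloor y \rfloor$ is the largest integer not exceeding $y$. For $n \in \mathbb{N} = \{1,2,3,\dots\}$ put $d_n(x) := d_1(T^{n-1}(x))$, where $T^{n-1}$ is the $(n-1)$-fold iterate of $T$ ($T^0$ is the identity). The sequence $(d_n(x))_{n \in \mathbb{N}}$ is the Pierce expansion digit sequence of $x$. Conventions: $\infty^s := \infty$ for $s>0$ and $c/\infty := 0$ for $c \in \mathbb{R}$. Convergence exponent: for $x \in [0,1]$, $\lambda^*(x) := \inf\{ s > 0 : \sum_{n \in \mathbb{N}} 1/(d_n(x))^s \text{ converges} \}$. The function $\lambda^*$ takes values in $[0,1]$. The interval $[0,1]$ carries the subspace topology induced by the standard topology of $\mathbb{R}$. *)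

theory Defs
  imports "HOL-Analysis.Analysis" "HOL-Library.Extended_Nat"
begin

text \<open>
  Pierce expansions. All functions below are only meaningful for arguments in \<open>{0..1}\<close>;
  this interval is invariant under \<open>pierce_T\<close>.
\<close>

definition pierce_d1 :: "real \<Rightarrow> enat" where
  "pierce_d1 x = (if x = 0 then \<infinity> else enat (nat \<lfloor>1 / x\<rfloor>))"

definition pierce_T :: "real \<Rightarrow> real" where
  "pierce_T x = (if x = 0 then 0 else 1 - of_int \<lfloor>1 / x\<rfloor> * x)"

text \<open>Digits are indexed from 1; the value at index 0 is irrelevant and never used.\<close>

definition pierce_digit :: "nat \<Rightarrow> real \<Rightarrow> enat" where
  "pierce_digit n x = pierce_d1 ((pierce_T ^^ (n - 1)) x)"

text \<open>
  The term \<open>1 / d powr s\<close> for an extended natural number \<open>d\<close>, under the conventions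
  \<open>\<infinity> powr s = \<infinity>\<close> for \<open>s > 0\<close> and \<open>c / \<infinity> = 0\<close>.
\<close>

definition recip_powr :: "enat \<Rightarrow> real \<Rightarrow> real" where
  "recip_powr d s = (case d of enat k \<Rightarrow> 1 / (real k powr s) | \<infinity> \<Rightarrow> 0)"

text \<open>
  The shift by \<open>Suc\<close> makes the series range over the indices \<open>1, 2, 3, \<dots>\<close>. The lemma
  \<open>pierce_conv_exp_set_nonempty\<close> below shows that the real-valued infimum is never taken
  over the empty set.
\<close>

definition pierce_conv_exp :: "real \<Rightarrow> real" where
  "pierce_conv_exp x =
     Inf {s. s > 0 \<and> summable (\<lambda>n. recip_powr (pierce_digit (Suc n) x) s)}"

lemma pierce_T_bound:
  assumes "0 \<le> y" "y \<le> 1 / (real n + 1)"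
  shows "0 \<le> pierce_T y \<and> pierce_T y \<le> 1 / (real n + 2)"
proof (cases "y = 0")
  case True
  then show ?thesis by (simp add: pierce_T_def)
next
  case False
  with assms have y: "y > 0" by simp
  define k where "k = \<lfloor>1 / y\<rfloor>"
  have "real n + 1 \<le> 1 / y" using assms y by (simp add: field_simps)
  then have "int n + 1 \<le> k" unfolding k_def by (simp add: le_floor_iff)
  then have k: "real n + 1 \<le> of_int k" by linarith
  have "of_int k \<le> 1 / y" "1 / y < of_int k + 1" unfolding k_def by linarith+
  then have ky: "of_int k * y \<le> 1" "1 < (of_int k + 1) * y"
    using y by (simp_all add: field_simps)
  have "(1 - of_int k * y) * (of_int k + 1) \<le> 1"
  proof -
    have "of_int k * 1 \<le> of_int k * ((of_int k + 1) * y)"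
      using ky k by (intro mult_left_mono) auto
    then show ?thesis by (simp add: algebra_simps)
  qed
  moreover have "(1 - of_int k * y) * (real n + 2) \<le> (1 - of_int k * y) * (of_int k + 1)"
    using ky k by (intro mult_left_mono) auto
  ultimately have "(1 - of_int k * y) * (real n + 2) \<le> 1" by linarith
  then have "1 - of_int k * y \<le> 1 / (real n + 2)" by (simp add: field_simps)
  then show ?thesis using ky False by (simp add: pierce_T_def k_def)
qed

lemma pierce_T_iterate_bound:
  assumes "x \<in> {0..1}"
  shows "0 \<le> (pierce_T ^^ n) x \<and> (pierce_T ^^ n) x \<le> 1 / (real n + 1)"
proof (induction n)
  case 0
  then show ?case using assms by simp
next
  case (Suc n)
  then show ?case using pierce_T_bound[of "(pierce_T ^^ n) x" n] by (simp add: add.commute)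
qed

lemma recip_powr_digit_le:
  assumes "x \<in> {0..1}" "s > 0"
  shows "0 \<le> recip_powr (pierce_digit (Suc n) x) s \<and>
         recip_powr (pierce_digit (Suc n) x) s \<le> 1 / (real (Suc n) powr s)"
proof (cases "(pierce_T ^^ n) x = 0")
  case True
  then show ?thesis by (simp add: recip_powr_def pierce_digit_def pierce_d1_def)
next
  case False
  define y where "y = (pierce_T ^^ n) x"
  have y: "0 < y" "y \<le> 1 / (real n + 1)"
    using pierce_T_iterate_bound[OF assms(1), of n] False by (auto simp: y_def)
  have "real n + 1 \<le> 1 / y" using y by (simp add: field_simps)
  then have "int n + 1 \<le> \<lfloor>1 / y\<rfloor>" by (simp add: le_floor_iff)
  then have le: "real (Suc n) \<le> real (nat \<lfloor>1 / y\<rfloor>)" by linarith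
  then have "real (Suc n) powr s \<le> real (nat \<lfloor>1 / y\<rfloor>) powr s"
    using assms(2) by (intro powr_mono2) auto
  then have "1 / (real (nat \<lfloor>1 / y\<rfloor>) powr s) \<le> 1 / (real (Suc n) powr s)"
    using le by (intro divide_left_mono mult_pos_pos) auto
  moreover have "recip_powr (pierce_digit (Suc n) x) s = 1 / (real (nat \<lfloor>1 / y\<rfloor>) powr s)"
    using y by (simp add: recip_powr_def pierce_digit_def pierce_d1_def y_def)
  ultimately show ?thesis by simp
qed

lemma summable_recip_powr_digit:
  assumes "x \<in> {0..1}" "s > 1"
  shows "summable (\<lambda>n. recip_powr (pierce_digit (Suc n) x) s)"
proof (rule summable_comparison_test')
  have "summable (\<lambda>n. real n powr (- s))"
    using assms(2) by (simp add: summable_real_powr_iff)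
  then have "summable (\<lambda>n. real (Suc n) powr (- s))"
    by (subst summable_Suc_iff)
  then show "summable (\<lambda>n. 1 / (real (Suc n) powr s))"
    by (simp add: powr_minus_divide)
  show "norm (recip_powr (pierce_digit (Suc n) x) s) \<le> 1 / (real (Suc n) powr s)" for n
    using recip_powr_digit_le[of x s n] assms by simp
qed

lemma pierce_conv_exp_set_nonempty:
  assumes "x \<in> {0..1}"
  shows "{s. s > 0 \<and> summable (\<lambda>n. recip_powr (pierce_digit (Suc n) x) s)} \<noteq> {}"
  using summable_recip_powr_digit[OF assms, of 2] by (auto intro!: exI[of _ 2])

lemma pierce_conv_exp_in_unit:
  assumes "x \<in> {0..1}"
  shows "pierce_conv_exp x \<in> {0..1}"
proof -
  let ?S = "{s. s > 0 \<and> summable (\<lambda>n. recip_powr (pierce_digit (Suc n) x) s)}"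
  have "0 \<le> Inf ?S"
    using pierce_conv_exp_set_nonempty[OF assms] by (intro cInf_greatest) auto
  moreover have "Inf ?S \<le> 1"
  proof (rule field_le_epsilon)
    fix e :: real
    assume "e > 0"
    then have "1 + e \<in> ?S" using summable_recip_powr_digit[OF assms, of "1 + e"] by simp
    then show "Inf ?S \<le> 1 + e" by (intro cInf_lower) (auto intro!: bdd_belowI[of _ 0])
  qed
  ultimately show ?thesis by (simp add: pierce_conv_exp_def)
qed

end

theory Submission
  imports Defs
begin

text \<open>
  Both level sets \<open>\<lambda>\<^sup>* = 0\<close> and \<open>\<lambda>\<^sup>* = 1\<close> are dense in \<open>{0..1}\<close>, so continuity at a point would
  force the value there to be \<open>0\<close> and \<open>1\<close> at once. Density of either set rests on the fact that
  the convergence exponent ignores finitely many digits, hence is invariant under \<open>pierce_T\<close>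
  (\<open>pierce_conv_exp_iterate\<close>).

  The rationals are dense, and each has a finite expansion: on fractions \<open>p / q\<close> the map
  \<open>pierce_T\<close> acts like a step of the Euclidean algorithm and lowers the numerator until it is
  \<open>0\<close> (\<open>rational_pierce_T_reaches_zero\<close>). So \<open>\<lambda>\<^sup>*\<close> vanishes at the rationals.

  For the value \<open>1\<close>, the numbers with digits \<open>n + 1, n + 2, n + 3, \<dots>\<close> have exponent \<open>1\<close>, since
  their series are tails of the series of \<open>1 / k powr s\<close>, and they tend to \<open>0\<close>. They are written
  here as \<open>\<integral>\<^sub>0\<^sup>1 t\<^sup>n exp (t - 1) dt\<close>; the first of them, with digits \<open>1, 2, 3, \<dots>\<close>, is
  \<open>1 - 1 / exp 1\<close>. Thus \<open>0\<close> is a limit of points of exponent \<open>1\<close>. A nonzero \<open>r\<close> inherits this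
  property from \<open>pierce_T r\<close>, because the inverse branch \<open>w \<mapsto> (1 - w) / d\<close> that belongs to the
  first digit \<open>d\<close> of \<open>r\<close> is continuous and is defined near \<open>pierce_T r\<close>
  (\<open>closure_conv_exp_level_set_pullback\<close>). Going back along the finite orbit of a rational
  number to \<open>0\<close> shows that every rational is a limit of points of exponent \<open>1\<close>.
\<close>

section \<open>Invariance of the convergence exponent under the Pierce map\<close>

lemma pierce_conv_exp_pierce_T: "pierce_conv_exp (pierce_T x) = pierce_conv_exp x"
proof -
  have "pierce_digit (Suc n) (pierce_T x) = pierce_digit (Suc (Suc n)) x" for n
    by (simp add: pierce_digit_def funpow_swap1)
  then show ?thesis
    unfolding pierce_conv_exp_def
    using summable_Suc_iff[of "\<lambda>n. recip_powr (pierce_digit (Suc n) x) s" for s] by simp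
qed

lemma pierce_conv_exp_iterate: "pierce_conv_exp ((pierce_T ^^ n) x) = pierce_conv_exp x"
  by (induction n) (simp_all add: pierce_conv_exp_pierce_T)

lemma pierce_conv_exp_0: "pierce_conv_exp 0 = 0"
proof -
  have "(pierce_T ^^ n) 0 = 0" for n
    by (induction n) (simp_all add: pierce_T_def)
  then have "recip_powr (pierce_digit (Suc n) 0) s = 0" for n s
    by (simp add: recip_powr_def pierce_digit_def pierce_d1_def)
  then have "pierce_conv_exp 0 = Inf {0<..}"
    by (simp add: pierce_conv_exp_def greaterThan_def)
  then show ?thesis by simp
qed

section \<open>Rational numbers have finite expansions\<close>

lemma pierce_T_fraction:
  assumes "p > 0"
  shows "pierce_T (real p / real q) = real (q mod p) / real q"
proof (cases "q = 0")
  case True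
  then show ?thesis by (simp add: pierce_T_def)
next
  case False
  have "\<lfloor>1 / (real p / real q)\<rfloor> = int (q div p)"
    by (simp add: floor_divide_of_nat_eq)
  moreover have "real q = real (q div p) * real p + real (q mod p)"
    by (metis div_mult_mod_eq of_nat_add of_nat_mult)
  ultimately show ?thesis
    using assms False by (simp add: pierce_T_def field_simps)
qed

lemma fraction_pierce_T_reaches_zero: "\<exists>n. (pierce_T ^^ n) (real p / real q) = 0"
proof (induction p rule: less_induct)
  case (less p)
  show ?case
  proof (cases "p = 0")
    case True
    then show ?thesis by (intro exI[of _ 0]) simp
  next
    case False
    then obtain n where "(pierce_T ^^ n) (real (q mod p) / real q) = 0"
      using less[of "q mod p"] by auto
    then have "(pierce_T ^^ Suc n) (real p / real q) = 0"
      using False by (simp add: funpow_Suc_right pierce_T_fraction del: funpow.simps)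
    then show ?thesis by blast
  qed
qed

lemma rational_pierce_T_reaches_zero:
  assumes "r \<in> \<rat>" "0 \<le> r"
  shows "\<exists>n. (pierce_T ^^ n) r = 0"
proof -
  from assms(1) obtain p q :: nat where "\<bar>r\<bar> = real p / real q"
    using Rats_abs_nat_div_natE by metis
  then show ?thesis
    using assms(2) fraction_pierce_T_reaches_zero[of p q] by simp
qed

section \<open>Numbers with consecutive integers as digits\<close>

text \<open>
  The number with Pierce digits \<open>n + 1, n + 2, n + 3, \<dots>\<close>. In integral form its sign and its
  monotonicity in \<open>n\<close> are immediate, and integration by parts gives the recurrence that says
  that \<open>pierce_T\<close> raises the index by one.
\<close>

definition consec_digits :: "nat \<Rightarrow> real" where
  "consec_digits n = integral {0..1} (\<lambda>t. t ^ n * exp (t - 1))"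

lemma consec_digits_integrable: "(\<lambda>t::real. t ^ n * exp (t - 1)) integrable_on {0..1}"
  by (intro integrable_continuous_interval continuous_intros)

lemma consec_digits_recurrence:
  "(real n + 1) * consec_digits n + consec_digits (Suc n) = 1"
proof -
  let ?f = "\<lambda>t::real. (real n + 1) * (t ^ n * exp (t - 1)) + t ^ Suc n * exp (t - 1)"
  have "(?f has_integral (1 ^ Suc n * exp (1 - 1) - 0 ^ Suc n * exp (0 - 1))) {0..1}"
  proof (rule fundamental_theorem_of_calculus)
    fix t :: real
    have "((\<lambda>t. t ^ Suc n * exp (t - 1)) has_real_derivative ?f t) (at t within {0..1})"
      by (rule derivative_eq_intros refl | simp del: power_Suc)+
    then show "((\<lambda>t. t ^ Suc n * exp (t - 1)) has_vector_derivative ?f t) (at t within {0..1})"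
      by (simp only: has_real_derivative_iff_has_vector_derivative)
  qed simp
  moreover have "(?f has_integral
      ((real n + 1) * consec_digits n + consec_digits (Suc n))) {0..1}"
    unfolding consec_digits_def
    by (intro has_integral_add has_integral_mult_right integrable_integral
        consec_digits_integrable)
  ultimately show ?thesis by (auto dest: has_integral_unique)
qed

lemma consec_digits_Suc_le: "consec_digits (Suc n) \<le> consec_digits n"
  unfolding consec_digits_def
  by (intro integral_le consec_digits_integrable mult_right_mono power_decreasing) auto

text \<open>
  Nonnegativity and weak monotonicity come from the integral; the recurrence makes them strict.
  A zero at index \<open>n\<close> would be followed by the larger value \<open>1\<close>, and two equal consecutive values
  would be followed by a zero. Strictness matters because it pins down the floor of
  \<open>1 / consec_digits n\<close>.
\<close>

lemma consec_digits_pos: "0 < consec_digits n"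
proof (rule ccontr)
  assume "\<not> 0 < consec_digits n"
  moreover have "0 \<le> consec_digits n"
    unfolding consec_digits_def by (intro integral_nonneg consec_digits_integrable) auto
  ultimately have "consec_digits n = 0" by simp
  then have "consec_digits (Suc n) = 1" using consec_digits_recurrence[of n] by simp
  then show False using consec_digits_Suc_le[of n] \<open>consec_digits n = 0\<close> by simp
qed

lemma consec_digits_bounds:
  "1 / (real n + 2) < consec_digits n" "consec_digits n < 1 / (real n + 1)"
proof -
  have rec: "(real n + 1) * consec_digits n + consec_digits (Suc n) = 1"
    and rec_Suc: "(real n + 2) * consec_digits (Suc n) + consec_digits (Suc (Suc n)) = 1"
    using consec_digits_recurrence[of n] consec_digits_recurrence[of "Suc n"]
    by (simp_all add: algebra_simps)
  have "(real n + 1) * consec_digits n < 1"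
    using rec consec_digits_pos[of "Suc n"] by linarith
  then show "consec_digits n < 1 / (real n + 1)" by (simp add: field_simps)
  have "(real n + 2) * consec_digits (Suc n) < 1"
    using rec_Suc consec_digits_pos[of "Suc (Suc n)"] by linarith
  moreover have "(real n + 1) * consec_digits (Suc n) \<le> (real n + 1) * consec_digits n"
    using consec_digits_Suc_le[of n] by (intro mult_left_mono) auto
  ultimately have "consec_digits (Suc n) < consec_digits n"
    using rec by (cases "consec_digits (Suc n) = consec_digits n")
      (use consec_digits_Suc_le[of n] in \<open>auto simp: algebra_simps\<close>)
  then have "1 < (real n + 2) * consec_digits n"
    using rec by (simp add: algebra_simps)
  then show "1 / (real n + 2) < consec_digits n" by (simp add: field_simps)
qed

lemma floor_inverse_consec_digits: "\<lfloor>1 / consec_digits n\<rfloor> = int n + 1"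
  using consec_digits_bounds[of n] consec_digits_pos[of n]
  by (intro floor_unique) (simp_all add: field_simps)

lemma pierce_T_consec_digits: "pierce_T (consec_digits n) = consec_digits (Suc n)"
  using consec_digits_recurrence[of n] consec_digits_pos[of n]
  by (simp add: pierce_T_def floor_inverse_consec_digits algebra_simps)

lemma pierce_digit_consec_digits: "pierce_digit (Suc k) (consec_digits n) = enat (Suc (k + n))"
proof -
  have "(pierce_T ^^ k) (consec_digits n) = consec_digits (k + n)"
    by (induction k) (simp_all add: pierce_T_consec_digits)
  then show ?thesis
    using consec_digits_pos[of "k + n"]
    by (simp add: pierce_digit_def pierce_d1_def floor_inverse_consec_digits nat_add_distrib)
qed

lemma pierce_conv_exp_consec_digits: "pierce_conv_exp (consec_digits n) = 1"
proof -
  have "summable (\<lambda>k. recip_powr (pierce_digit (Suc k) (consec_digits n)) s) \<longleftrightarrow> s > 1" for s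
  proof -
    have "recip_powr (pierce_digit (Suc k) (consec_digits n)) s = real (k + Suc n) powr (- s)" for k
      by (simp add: pierce_digit_consec_digits recip_powr_def powr_minus_divide)
    then show ?thesis
      using summable_iff_shift[of "\<lambda>k. real k powr (- s)" "Suc n"]
      by (simp add: summable_real_powr_iff)
  qed
  then have "pierce_conv_exp (consec_digits n) = Inf {s. s > 0 \<and> s > 1}"
    by (simp only: pierce_conv_exp_def)
  also have "{s. s > 0 \<and> s > 1} = {1::real<..}" by auto
  finally show ?thesis by simp
qed

lemma consec_digits_tendsto_0: "consec_digits \<longlonglongrightarrow> 0"
proof (rule tendsto_sandwich[where f = "\<lambda>_. 0"])
  show "(\<lambda>n. 1 / (real n + 1)) \<longlonglongrightarrow> 0"
    using LIMSEQ_inverse_real_of_nat by (simp add: inverse_eq_divide add.commute)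
  show "\<forall>\<^sub>F n in sequentially. consec_digits n \<le> 1 / (real n + 1)"
    using consec_digits_bounds(2) by (simp add: less_imp_le)
  show "\<forall>\<^sub>F n in sequentially. 0 \<le> consec_digits n"
    using consec_digits_pos by (simp add: less_imp_le)
qed simp

section \<open>Density of the level sets\<close>

lemma zero_in_closure_conv_exp_1: "0 \<in> closure {y \<in> {0..1}. pierce_conv_exp y = 1}"
  unfolding closure_sequential
proof (intro exI[of _ consec_digits] conjI allI)
  fix n
  have "1 / (real n + 1) \<le> 1" by simp
  then have "consec_digits n \<le> 1" using consec_digits_bounds(2)[of n] by linarith
  then show "consec_digits n \<in> {y \<in> {0..1}. pierce_conv_exp y = 1}"
    using consec_digits_pos[of n] by (simp add: pierce_conv_exp_consec_digits)
qed (rule consec_digits_tendsto_0)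

text \<open>
  The map \<open>w \<mapsto> (1 - w) / d\<close> inverts \<open>pierce_T\<close> on \<open>0 \<le> w < 1 / (d + 1)\<close>, and \<open>pierce_T r\<close> lies
  strictly below the upper end of this range because \<open>1 / r < d + 1\<close>. So approximants of
  \<open>pierce_T r\<close> in the level set are carried to approximants of \<open>r\<close>, with the same exponent.
\<close>

lemma closure_conv_exp_level_set_pullback:
  assumes "0 < r" "r \<le> 1"
    and "pierce_T r \<in> closure {y \<in> {0..1}. pierce_conv_exp y = c}"
  shows "r \<in> closure {y \<in> {0..1}. pierce_conv_exp y = c}"
proof -
  define k where "k = \<lfloor>1 / r\<rfloor>"
  define d where "d = real_of_int k"
  have "k \<ge> 1" using assms(1,2) by (simp add: k_def le_floor_iff)
  then have d: "d \<ge> 1" by (simp add: d_def)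
  have T: "pierce_T r = 1 - d * r" using assms(1) by (simp add: pierce_T_def k_def d_def)
  have "1 / r < d + 1" by (simp add: d_def k_def)
  then have "1 < (d + 1) * r" using assms(1) by (simp add: field_simps)
  then have "d * 1 < d * ((d + 1) * r)" using d by (intro mult_strict_left_mono) auto
  then have T_less: "pierce_T r < 1 / (d + 1)" using d by (simp add: T field_simps)
  show ?thesis
    unfolding closure_approachable
  proof (intro allI impI)
    fix e :: real
    assume "e > 0"
    then have "min e (1 / (d + 1) - pierce_T r) > 0" using T_less by simp
    then obtain w where "w \<in> {y \<in> {0..1}. pierce_conv_exp y = c}"
      and dist_w: "dist w (pierce_T r) < min e (1 / (d + 1) - pierce_T r)"
      using assms(3) unfolding closure_approachable by blast
    then have w: "0 \<le> w" "pierce_conv_exp w = c" by auto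
    define y where "y = (1 - w) / d"
    have w_less: "w < 1 / (d + 1)" using dist_w by (auto simp: dist_real_def)
    moreover have "1 / (d + 1) < 1" using d by simp
    ultimately have "w < 1" by linarith
    then have y: "0 < y" "y \<le> 1" using w(1) d by (auto simp: y_def field_simps)
    have "\<lfloor>1 / y\<rfloor> = k"
      by (rule floor_unique) (use w_less w(1) \<open>w < 1\<close> d in \<open>simp_all add: y_def d_def field_simps\<close>)
    then have "pierce_T y = w" using y \<open>w < 1\<close> d by (simp add: pierce_T_def d_def y_def)
    then have "pierce_conv_exp y = c" using pierce_conv_exp_pierce_T[of y] w(2) by simp
    moreover have "dist y r < e"
    proof -
      have "y - r = (pierce_T r - w) / d" using d by (simp add: y_def T field_simps)
      then have "\<bar>y - r\<bar> = \<bar>w - pierce_T r\<bar> / d" using d by (simp add: abs_minus_commute)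
      also have "\<dots> \<le> \<bar>w - pierce_T r\<bar>" using d by (simp add: divide_le_eq mult_le_cancel_left1)
      finally show ?thesis using dist_w by (simp add: dist_real_def)
    qed
    ultimately show "\<exists>y\<in>{y \<in> {0..1}. pierce_conv_exp y = c}. dist y r < e"
      using y by (intro bexI[of _ y]) auto
  qed
qed

lemma in_closure_conv_exp_1_if_pierce_T_reaches_zero:
  assumes "r \<in> {0..1}" "(pierce_T ^^ n) r = 0"
  shows "r \<in> closure {y \<in> {0..1}. pierce_conv_exp y = 1}"
  using assms
proof (induction n arbitrary: r)
  case 0
  then show ?case using zero_in_closure_conv_exp_1 by simp
next
  case (Suc n)
  have "pierce_T r \<in> {0..1}"
    using pierce_T_iterate_bound[OF Suc.prems(1), of 1] by auto
  moreover have "(pierce_T ^^ n) (pierce_T r) = 0"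
    using Suc.prems(2) by (simp add: funpow_swap1)
  ultimately have "pierce_T r \<in> closure {y \<in> {0..1}. pierce_conv_exp y = 1}"
    by (rule Suc.IH)
  then show ?case
    using closure_conv_exp_level_set_pullback[of r 1] zero_in_closure_conv_exp_1 Suc.prems(1)
    by (cases "r = 0") auto
qed

lemma rationals_dense_unit_interval:
  fixes x :: real
  assumes "x \<in> {0..1}"
  shows "x \<in> closure (\<rat> \<inter> {0..1})"
  unfolding closure_approachable
proof (intro allI impI)
  fix e :: real
  assume "e > 0"
  then have "max 0 (x - e) < min 1 (x + e)" using assms by auto
  then obtain r where "r \<in> \<rat>" "max 0 (x - e) < r" "r < min 1 (x + e)"
    using Rats_dense_in_real by blast
  then show "\<exists>r\<in>\<rat> \<inter> {0..1}. dist r x < e"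
    by (intro bexI[of _ r]) (auto simp: dist_real_def)
qed

lemma conv_exp_0_dense:
  assumes "x \<in> {0..1}"
  shows "x \<in> closure {y \<in> {0..1}. pierce_conv_exp y = 0}"
proof -
  have "\<rat> \<inter> {0..1} \<subseteq> {y \<in> {0..1}. pierce_conv_exp y = 0}"
  proof
    fix r :: real
    assume r: "r \<in> \<rat> \<inter> {0..1}"
    then obtain n where "(pierce_T ^^ n) r = 0"
      using rational_pierce_T_reaches_zero by auto
    then have "pierce_conv_exp r = 0"
      using pierce_conv_exp_iterate[of n r] by (simp add: pierce_conv_exp_0)
    then show "r \<in> {y \<in> {0..1}. pierce_conv_exp y = 0}" using r by simp
  qed
  then show ?thesis using rationals_dense_unit_interval[OF assms] closure_mono by blast
qed

lemma conv_exp_1_dense: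
  assumes "x \<in> {0..1}"
  shows "x \<in> closure {y \<in> {0..1}. pierce_conv_exp y = 1}"
proof -
  have "\<rat> \<inter> {0..1} \<subseteq> closure {y \<in> {0..1}. pierce_conv_exp y = 1}"
    using rational_pierce_T_reaches_zero in_closure_conv_exp_1_if_pierce_T_reaches_zero
    by fastforce
  then show ?thesis
    using rationals_dense_unit_interval[OF assms] closure_minimal[OF _ closed_closure] by blast
qed

section \<open>Discontinuity\<close>

lemma continuous_within_level_set_closure:
  fixes f :: "'a::metric_space \<Rightarrow> 'b::metric_space"
  assumes "continuous (at x within S) f" "x \<in> closure {y \<in> S. f y = c}"
  shows "f x = c"
proof -
  obtain u where u: "\<And>n. u n \<in> S" "\<And>n. f (u n) = c" "u \<longlonglongrightarrow> x"
    using assms(2) unfolding closure_sequential by auto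
  then have "(f \<circ> u) \<longlonglongrightarrow> f x"
    using assms(1) unfolding continuous_within_sequentially by blast
  then show ?thesis using u(2) by (simp add: o_def LIMSEQ_const_iff)
qed

theorem corollary1p4:
  fixes x :: real
  assumes "x \<in> {0..1}"
  shows "\<not> continuous (at x within {0..1}) pierce_conv_exp"
proof
  assume cont: "continuous (at x within {0..1}) pierce_conv_exp"
  have "pierce_conv_exp x = 0"
    by (rule continuous_within_level_set_closure[OF cont conv_exp_0_dense[OF assms]])
  moreover have "pierce_conv_exp x = 1"
    by (rule continuous_within_level_set_closure[OF cont conv_exp_1_dense[OF assms]])
  ultimately show False by simp
qed

end
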